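(* Let $f_1,f_2:\mathbb{R}^d\to\mathbb{R}$ be in $\mathcal{C}^1$, $x_0\in\mathbb{R}^d$, $\bar\Delta>0$, and for $i\in\{1,2\}$ let $\{\widetilde f_{i,\Delta}\}_{\Delta\in(0,\bar\Delta]}$ be a class of (differentiable) models of $f_i$. Assume $f_2(x)\ne0$ and $\widetilde f_{2,\Delta}(x)\ne0$ for all $\Delta\in(0,\bar\Delta]$ and $x\in B_\Delta(x_0)$, and put $F=f_1/f_2$, $\widetilde F_\Delta=\widetilde f_{1,\Delta}/\widetilde f_{2,\Delta}$. Suppose that for $i\in\{1,2\}$ the class $\{\widetilde f_{i,\Delta}\}_{(0,\bar\Delta]}$ provides order-$\infty$ function accuracy of $f_i$ at $x_0$ with constant $\kappa_i^f(x_0)=0$, and order-$N_i^g$ gradient accuracy of $f_i$ at $x_0$ with constant $\kappa_i^g(x_0)$, where $N_i^g\ge0$. Let $N_F^g=\min\{N_1^g,N_2^g\}$. Then for every $\Delta\in(0,\bar\Delta]$ $$\|\nabla F(x_0)-\nabla\widetilde F_\Delta(x_0)\|\le K_F^g(x_0)\Delta^{N_F^g},$$ where $$K_F^g(x_0)=\left|\frac1{f_2(x_0)}\right|\kappa_1^g(x_0)\bar\Delta^{N_1^g-N_F^g}+\left|\frac{f_1(x_0)}{f_2^2(x_0)}\right|\kappa_2^g(x_0)\bar\Delta^{N_2^g-N_F^g}.$$ In particular, $\{\widetilde F_\Delta\}_{(0,\bar\Delta]}$ provides order-$N_F^g$ gradient accuracy of $F$ at $x_0$.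
   Context: $\|\cdot\|$ is the Euclidean norm and $B_\Delta(x_0)$ is the closed ball of radius $\Delta$ centered at $x_0$. A class of models of $f:\mathbb{R}^d\to\mathbb{R}$ is a family of functions $\widetilde f_\Delta:\mathbb{R}^d\to\mathbb{R}$ indexed by $\Delta\in(0,\bar\Delta]$; when gradients of models appear the models are understood to be differentiable. Order-$\infty$ function accuracy of $f$ at $x_0$ with constant $0$ means $\widetilde f_\Delta(x_0)=f(x_0)$ for all $\Delta\in(0,\bar\Delta]$. For real $N\ge0$ and $\kappa\ge0$, the class provides order-$N$ gradient accuracy of $f$ at $x_0$ with constant $\kappa$ if $\|\nabla f(x_0)-\nabla\widetilde f_\Delta(x_0)\|\le\kappa\Delta^N$ for all $\Delta\in(0,\bar\Delta]$. Without mention of a constant, it is meant that some such $\kappa\ge0$ exists. The quotients $F,\widetilde F_\Delta$ are considered where the denominators are nonzero. *)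

theory Defs
  imports "HOL-Analysis.Analysis"
begin

definition gradient :: "('a::real_inner \<Rightarrow> real) \<Rightarrow> 'a \<Rightarrow> 'a" where
  "gradient f x = (THE D. GDERIV f x :> D)"

lemma gradient_eqI:
  fixes f :: "'a::euclidean_space \<Rightarrow> real"
  assumes "GDERIV f x :> D"
  shows "gradient f x = D"
  unfolding gradient_def
proof (rule the_equality)
  fix D' assume "GDERIV f x :> D'"
  with assms have "(\<lambda>h. inner h D') = (\<lambda>h. inner h D)"
    unfolding gderiv_def using has_derivative_unique by blast
  then show "D' = D"
    by (metis euclidean_eqI inner_commute)
qed (fact assms)

lemma GDERIV_gradient:
  fixes f :: "'a::euclidean_space \<Rightarrow> real"
  assumes "f differentiable (at x)"
  shows "GDERIV f x :> gradient f x"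
proof -
  from assms obtain f' where f': "(f has_derivative f') (at x)"
    unfolding differentiable_def by blast
  then interpret bounded_linear f' by (rule has_derivative_bounded_linear)
  have "f' = (\<lambda>h. inner h (adjoint f' 1))"
    using adjoint_works[OF linear_axioms, of _ 1] by (auto simp: inner_real_def)
  with f' have "GDERIV f x :> adjoint f' 1"
    unfolding gderiv_def by simp
  then show ?thesis using gradient_eqI by metis
qed

definition C1_function :: "('a::euclidean_space \<Rightarrow> real) \<Rightarrow> bool" where
  "C1_function f \<longleftrightarrow> f differentiable_on UNIV \<and> continuous_on UNIV (gradient f)"

text \<open>A class of models is a map \<open>m\<close> from \<open>\<Delta>\<close> to functions, of which only the members
  with \<open>0 < \<Delta> \<le> \<Delta>bar\<close> are relevant.\<close>

definition differentiable_models :: "real \<Rightarrow> (real \<Rightarrow> 'a::euclidean_space \<Rightarrow> real) \<Rightarrow> bool" where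
  "differentiable_models \<Delta>bar m \<longleftrightarrow> (\<forall>\<Delta>\<in>{0<..\<Delta>bar}. m \<Delta> differentiable_on UNIV)"

text \<open>Function accuracy of order infinity with constant zero.\<close>

definition exact_function_accuracy ::
  "real \<Rightarrow> ('a::euclidean_space \<Rightarrow> real) \<Rightarrow> (real \<Rightarrow> 'a \<Rightarrow> real) \<Rightarrow> 'a \<Rightarrow> bool" where
  "exact_function_accuracy \<Delta>bar f m x0 \<longleftrightarrow> (\<forall>\<Delta>\<in>{0<..\<Delta>bar}. m \<Delta> x0 = f x0)"

text \<open>Since \<^const>\<open>gradient\<close> is total, the existence of the gradients at \<open>x0\<close> is stated
  explicitly. The exponent \<open>N\<close> is real, hence \<open>powr\<close>; its base \<open>\<Delta>\<close> is positive.\<close>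

definition gradient_accuracy_const ::
  "real \<Rightarrow> ('a::euclidean_space \<Rightarrow> real) \<Rightarrow> (real \<Rightarrow> 'a \<Rightarrow> real) \<Rightarrow> 'a \<Rightarrow> real \<Rightarrow> real \<Rightarrow> bool" where
  "gradient_accuracy_const \<Delta>bar f m x0 N \<kappa> \<longleftrightarrow>
     f differentiable (at x0) \<and>
     (\<forall>\<Delta>\<in>{0<..\<Delta>bar}. m \<Delta> differentiable (at x0) \<and>
        norm (gradient f x0 - gradient (m \<Delta>) x0) \<le> \<kappa> * \<Delta> powr N)"

definition gradient_accuracy ::
  "real \<Rightarrow> ('a::euclidean_space \<Rightarrow> real) \<Rightarrow> (real \<Rightarrow> 'a \<Rightarrow> real) \<Rightarrow> 'a \<Rightarrow> real \<Rightarrow> bool" where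
  "gradient_accuracy \<Delta>bar f m x0 N \<longleftrightarrow> (\<exists>\<kappa>\<ge>0. gradient_accuracy_const \<Delta>bar f m x0 N \<kappa>)"

end

theory Submission
  imports Defs
begin

text \<open>The models are exact at \<open>x0\<close>, so the quotient rule expresses both gradients with the same
  coefficients \<open>1 / f2 x0\<close> and \<open>f1 x0 / (f2 x0)\<^sup>2\<close>; their difference is therefore the same linear
  combination of the two gradient errors.\<close>

text \<open>The derivative given by the quotient rule is a functional of \<open>h\<close>;
  collecting its terms as one inner product with \<open>h\<close> exhibits the gradient. The
  coefficients involve only the values \<open>f x\<close> and \<open>g x\<close>, so pairs of
  functions that agree at \<open>x\<close> share them.\<close>

lemma gradient_divide:
  fixes f g :: "'a::euclidean_space \<Rightarrow> real"
  assumes "f differentiable (at x)" and "g differentiable (at x)" and "g x \<noteq> 0"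
  shows "gradient (\<lambda>y. f y / g y) x = (1 / g x) *\<^sub>R gradient f x - (f x / (g x)\<^sup>2) *\<^sub>R gradient g x"
proof (rule gradient_eqI)
  have "((\<lambda>y. f y / g y) has_derivative
      (\<lambda>h. - f x * (inverse (g x) * inner h (gradient g x) * inverse (g x))
        + inner h (gradient f x) / g x)) (at x)"
    using assms by (intro has_derivative_divide) (auto dest: GDERIV_gradient simp: gderiv_def)
  then show "GDERIV (\<lambda>y. f y / g y) x :>
      (1 / g x) *\<^sub>R gradient f x - (f x / (g x)\<^sup>2) *\<^sub>R gradient g x"
    unfolding gderiv_def
    by (rule has_derivative_eq_rhs) (simp add: fun_eq_iff inner_diff_right field_simps power2_eq_square)
qed

text \<open>Split off the surplus exponent \<open>N - M\<close>: it is nonnegative, so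
  \<open>powr\<close> is monotone in its base there and \<open>x\<close> may be replaced by its
  upper bound \<open>b\<close>. This lets a higher order be traded for a lower one at the cost of a
  constant.\<close>

lemma powr_le_powr_mult:
  fixes x b N M :: real
  assumes "0 < x" and "x \<le> b" and "M \<le> N"
  shows "x powr N \<le> b powr (N - M) * x powr M"
proof -
  have "x powr N = x powr (N - M) * x powr M"
    by (simp flip: powr_add)
  also have "\<dots> \<le> b powr (N - M) * x powr M"
    using assms by (intro mult_right_mono powr_mono2) auto
  finally show ?thesis .
qed

theorem theorem23:
  fixes f1 f2 :: "real ^ 'd \<Rightarrow> real"
    and m1 m2 :: "real \<Rightarrow> real ^ 'd \<Rightarrow> real"
    and x0 :: "real ^ 'd"
    and \<Delta>bar N1 N2 \<kappa>1 \<kappa>2 :: real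
  assumes "C1_function f1" and "C1_function f2"
    and "\<Delta>bar > 0"
    and "differentiable_models \<Delta>bar m1" and "differentiable_models \<Delta>bar m2"
    and "\<forall>\<Delta>\<in>{0<..\<Delta>bar}. \<forall>x\<in>cball x0 \<Delta>. f2 x \<noteq> 0 \<and> m2 \<Delta> x \<noteq> 0"
    and "exact_function_accuracy \<Delta>bar f1 m1 x0"
    and "exact_function_accuracy \<Delta>bar f2 m2 x0"
    and "N1 \<ge> 0" and "N2 \<ge> 0" and "\<kappa>1 \<ge> 0" and "\<kappa>2 \<ge> 0"
    and "gradient_accuracy_const \<Delta>bar f1 m1 x0 N1 \<kappa>1"
    and "gradient_accuracy_const \<Delta>bar f2 m2 x0 N2 \<kappa>2"
  shows "let F = (\<lambda>x. f1 x / f2 x);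
             mF = (\<lambda>\<Delta> x. m1 \<Delta> x / m2 \<Delta> x);
             NF = min N1 N2;
             KF = \<bar>1 / f2 x0\<bar> * \<kappa>1 * \<Delta>bar powr (N1 - NF)
                + \<bar>f1 x0 / (f2 x0)\<^sup>2\<bar> * \<kappa>2 * \<Delta>bar powr (N2 - NF)
         in (\<forall>\<Delta>\<in>{0<..\<Delta>bar}.
               norm (gradient F x0 - gradient (mF \<Delta>) x0) \<le> KF * \<Delta> powr NF)
          \<and> gradient_accuracy \<Delta>bar F mF x0 NF"
proof -
  define NF where "NF = min N1 N2"
  define KF where "KF = \<bar>1 / f2 x0\<bar> * \<kappa>1 * \<Delta>bar powr (N1 - NF)
      + \<bar>f1 x0 / (f2 x0)\<^sup>2\<bar> * \<kappa>2 * \<Delta>bar powr (N2 - NF)"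
  have "KF \<ge> 0"
    using assms(11,12) by (simp add: KF_def)
  \<comment> \<open>Take \<Delta> = \<open>\<Delta>bar\<close> and the centre of the ball.\<close>
  have f2_nz: "f2 x0 \<noteq> 0"
    using assms(3,6) by (metis centre_in_cball greaterThanAtMost_iff less_eq_real_def)
  have f_diff: "f1 differentiable (at x0)" "f2 differentiable (at x0)"
    using assms(13,14) by (auto simp: gradient_accuracy_const_def)
  \<comment> \<open>Differentiability is carried along with the bound because
    \<open>gradient_accuracy_const\<close> demands both of every model.\<close>
  have error: "(\<lambda>x. m1 \<Delta> x / m2 \<Delta> x) differentiable (at x0) \<and>
      norm (gradient (\<lambda>x. f1 x / f2 x) x0 - gradient (\<lambda>x. m1 \<Delta> x / m2 \<Delta> x) x0) \<le> KF * \<Delta> powr NF"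
    if "\<Delta> \<in> {0<..\<Delta>bar}" for \<Delta>
  proof -
    have m_diff: "m1 \<Delta> differentiable (at x0)" "m2 \<Delta> differentiable (at x0)"
      and acc: "norm (gradient f1 x0 - gradient (m1 \<Delta>) x0) \<le> \<kappa>1 * \<Delta> powr N1"
        "norm (gradient f2 x0 - gradient (m2 \<Delta>) x0) \<le> \<kappa>2 * \<Delta> powr N2"
      using assms(13,14) that by (auto simp: gradient_accuracy_const_def)
    have m_eq: "m1 \<Delta> x0 = f1 x0" "m2 \<Delta> x0 = f2 x0"
      using assms(7,8) that by (auto simp: exact_function_accuracy_def)
    \<comment> \<open>To be used with \<open>N1\<close> and \<open>N2\<close>, which brings both
      errors to the common order \<open>NF\<close>; these are the powers of
      \<open>\<Delta>bar\<close> in \<open>KF\<close>.\<close>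
    have powr_le: "\<Delta> powr N \<le> \<Delta>bar powr (N - NF) * \<Delta> powr NF" if "NF \<le> N" for N
      using that \<open>\<Delta> \<in> {0<..\<Delta>bar}\<close> by (intro powr_le_powr_mult) auto
    have "gradient (\<lambda>x. f1 x / f2 x) x0 - gradient (\<lambda>x. m1 \<Delta> x / m2 \<Delta> x) x0
        = (1 / f2 x0) *\<^sub>R (gradient f1 x0 - gradient (m1 \<Delta>) x0)
          - (f1 x0 / (f2 x0)\<^sup>2) *\<^sub>R (gradient f2 x0 - gradient (m2 \<Delta>) x0)"
      using f_diff m_diff f2_nz m_eq by (simp add: gradient_divide algebra_simps)
    then have "norm (gradient (\<lambda>x. f1 x / f2 x) x0 - gradient (\<lambda>x. m1 \<Delta> x / m2 \<Delta> x) x0)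
        \<le> \<bar>1 / f2 x0\<bar> * norm (gradient f1 x0 - gradient (m1 \<Delta>) x0)
          + \<bar>f1 x0 / (f2 x0)\<^sup>2\<bar> * norm (gradient f2 x0 - gradient (m2 \<Delta>) x0)"
      by (simp only: norm_scaleR[symmetric] norm_triangle_ineq4)
    also have "\<dots> \<le> \<bar>1 / f2 x0\<bar> * (\<kappa>1 * (\<Delta>bar powr (N1 - NF) * \<Delta> powr NF))
          + \<bar>f1 x0 / (f2 x0)\<^sup>2\<bar> * (\<kappa>2 * (\<Delta>bar powr (N2 - NF) * \<Delta> powr NF))"
      using assms(11,12)
      by (intro add_mono mult_left_mono order_trans[OF acc(1)] order_trans[OF acc(2)] powr_le)
        (auto simp: NF_def)
    also have "\<dots> = KF * \<Delta> powr NF"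
      by (simp add: KF_def ring_distribs mult.assoc)
    \<comment> \<open>The quotient of the models is differentiable at \<open>x0\<close> since
      exactness gives its denominator the nonzero value \<open>f2 x0\<close>.\<close>
    finally show ?thesis
      using m_diff m_eq f2_nz by simp
  qed
  moreover have "(\<lambda>x. f1 x / f2 x) differentiable (at x0)"
    using f_diff f2_nz by (rule differentiable_divide)
  \<comment> \<open>\<open>KF\<close> is independent of \<Delta> and nonnegative, so it serves as
    the witness for the accuracy constant.\<close>
  ultimately have "gradient_accuracy \<Delta>bar (\<lambda>x. f1 x / f2 x) (\<lambda>\<Delta> x. m1 \<Delta> x / m2 \<Delta> x) x0 NF"
    using \<open>KF \<ge> 0\<close> unfolding gradient_accuracy_def gradient_accuracy_const_def by (intro exI[of _ KF]) simp
  with error show ?thesis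
    unfolding Let_def KF_def NF_def by simp
qed

end
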